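(* Let $\mathcal{Y}$ be an $m\times n$ zero-nonzero pattern and let $G$ be a finite simple graph with a partition $(V_1,V_2)$ according to $\mathcal{Y}$. Let $k$ be the smallest size of a zero forcing set $F$ for $G$ that forces from $V_1$ to $V_2$. Then $\operatorname{tri}(\mathcal{Y}) = m+n-k$.
   Context: A zero-nonzero pattern is a matrix with entries in $\{0,*\}$; a square pattern is a triangle if some permutation of its rows followed by some independent permutation of its columns yields a lower-triangular pattern with only $*$ entries on the diagonal; $\operatorname{tri}(\mathcal{Y})$ is the largest size of a square submatrix of $\mathcal{Y}$ that is a triangle. For a graph $G$ on $m+n$ vertices, disjoint sets $V_1=\{r_1,\dots,r_m\}$, $V_2=\{c_1,\dots,c_n\}$ with $V(G)=V_1\cup V_2$ form a partition of $G$ according to $\mathcal{Y}$ if $r_i$ is adjacent to $c_j$ exactly when the $(i,j)$ entry of $\mathcal{Y}$ is $*$ (edges within $V_1$ or within $V_2$ are unrestricted). Zero forcing rule: a filled vertex $v$ forces an unfilled vertex $u$ if $u$ is the only unfilled neighbor of $v$; each vertex forces at most once. A forcing sequence from $F$ is complete if no further force is possible afterwards; $F$ is a zero forcing set if repeated forcing fills all vertices. A zero forcing set $F$ forces from $V_1$ to $V_2$ if $V_1\subseteq F$ and there is a complete forcing sequence from $F$ in which every vertex that forces is in $V_1$ and every vertex that gets forced is in $V_2$ (such $F$ always exists, e.g. $F=V(G)$). *)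

theory Defs
  imports
    "Graph_Theory.Digraph"
    "Jordan_Normal_Form.DL_Submatrix"
    "HOL-Combinatorics.Permutations"
begin

section \<open>Zero-nonzero patterns and triangles\<close>

text \<open>Rows and columns are indexed from 0, as usual for \<^typ>\<open>'a mat\<close>.\<close>

datatype pattern_entry = Zero | Star

definition permute_rows_cols :: "(nat \<Rightarrow> nat) \<Rightarrow> (nat \<Rightarrow> nat) \<Rightarrow> 'a mat \<Rightarrow> 'a mat" where
  "permute_rows_cols p q A = mat (dim_row A) (dim_col A) (\<lambda>(i, j). A $$ (p i, q j))"

definition lower_triangular_pattern :: "pattern_entry mat \<Rightarrow> bool" where
  "lower_triangular_pattern A \<longleftrightarrow>
     (\<forall>i < dim_row A. \<forall>j < dim_col A. i < j \<longrightarrow> A $$ (i, j) = Zero)"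

definition is_triangle :: "pattern_entry mat \<Rightarrow> bool" where
  "is_triangle A \<longleftrightarrow>
     square_mat A \<and>
     (\<exists>p q. p permutes {..<dim_row A} \<and> q permutes {..<dim_col A} \<and>
        lower_triangular_pattern (permute_rows_cols p q A) \<and>
        (\<forall>i < dim_row A. permute_rows_cols p q A $$ (i, i) = Star))"

text \<open>The empty submatrix counts as a triangle of size 0, so the maximum is taken over a
  nonempty set and an all-zero pattern has triangle number 0.\<close>

definition tri :: "pattern_entry mat \<Rightarrow> nat" where
  "tri Y = Max {dim_row (submatrix Y I J) | I J.
     I \<subseteq> {..<dim_row Y} \<and> J \<subseteq> {..<dim_col Y} \<and> is_triangle (submatrix Y I J)}"

section \<open>Partitions of a graph according to a pattern\<close>

text \<open>A finite simple graph is a \<^locale>\<open>graph\<close>, i.e. a finite symmetric digraph without loops and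
  multiple arcs; \<^term>\<open>u \<rightarrow>\<^bsub>G\<^esub> v\<close> is adjacency.\<close>

definition partition_according ::
  "('a, 'b) pre_digraph \<Rightarrow> pattern_entry mat \<Rightarrow> 'a set \<Rightarrow> 'a set \<Rightarrow> bool" where
  "partition_according G Y V1 V2 \<longleftrightarrow>
     V1 \<inter> V2 = {} \<and> verts G = V1 \<union> V2 \<and>
     (\<exists>r c. bij_betw r {..<dim_row Y} V1 \<and> bij_betw c {..<dim_col Y} V2 \<and>
        (\<forall>i < dim_row Y. \<forall>j < dim_col Y. r i \<rightarrow>\<^bsub>G\<^esub> c j \<longleftrightarrow> Y $$ (i, j) = Star))"

section \<open>Zero forcing\<close>

definition can_force :: "('a, 'b) pre_digraph \<Rightarrow> 'a set \<Rightarrow> 'a \<Rightarrow> 'a \<Rightarrow> bool" where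
  "can_force G S v u \<longleftrightarrow> v \<in> S \<and> {w \<in> verts G. v \<rightarrow>\<^bsub>G\<^esub> w \<and> w \<notin> S} = {u}"

text \<open>A sequence of forces is a list of pairs (forcing vertex, forced vertex).\<close>

definition filled_after :: "'a set \<Rightarrow> ('a \<times> 'a) list \<Rightarrow> 'a set" where
  "filled_after F fs = F \<union> snd ` set fs"

definition forcing_sequence ::
  "('a, 'b) pre_digraph \<Rightarrow> 'a set \<Rightarrow> ('a \<times> 'a) list \<Rightarrow> bool" where
  "forcing_sequence G F fs \<longleftrightarrow>
     F \<subseteq> verts G \<and> distinct (map fst fs) \<and>
     (\<forall>i < length fs.
        can_force G (filled_after F (take i fs)) (fst (fs ! i)) (snd (fs ! i)))"

definition complete_forcing_sequence ::
  "('a, 'b) pre_digraph \<Rightarrow> 'a set \<Rightarrow> ('a \<times> 'a) list \<Rightarrow> bool" where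
  "complete_forcing_sequence G F fs \<longleftrightarrow>
     forcing_sequence G F fs \<and> (\<nexists>v u. forcing_sequence G F (fs @ [(v, u)]))"

definition zero_forcing_set :: "('a, 'b) pre_digraph \<Rightarrow> 'a set \<Rightarrow> bool" where
  "zero_forcing_set G F \<longleftrightarrow>
     F \<subseteq> verts G \<and> (\<exists>fs. forcing_sequence G F fs \<and> filled_after F fs = verts G)"

definition forces_from_to :: "('a, 'b) pre_digraph \<Rightarrow> 'a set \<Rightarrow> 'a set \<Rightarrow> 'a set \<Rightarrow> bool" where
  "forces_from_to G V1 V2 F \<longleftrightarrow>
     V1 \<subseteq> F \<and>
     (\<exists>fs. complete_forcing_sequence G F fs \<and> fst ` set fs \<subseteq> V1 \<and> snd ` set fs \<subseteq> V2)"

definition min_forcing_size :: "('a, 'b) pre_digraph \<Rightarrow> 'a set \<Rightarrow> 'a set \<Rightarrow> nat" where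
  "min_forcing_size G V1 V2 = Min {card F | F. zero_forcing_set G F \<and> forces_from_to G V1 V2 F}"

text \<open>The sets under \<^const>\<open>Max\<close> and \<^const>\<open>Min\<close> above are finite and nonempty.\<close>

lemma tri_set_finite_nonempty:
  fixes Y :: "pattern_entry mat"
  defines "S \<equiv> {dim_row (submatrix Y I J) | I J.
     I \<subseteq> {..<dim_row Y} \<and> J \<subseteq> {..<dim_col Y} \<and> is_triangle (submatrix Y I J)}"
  shows "finite S" "S \<noteq> {}"
proof -
  have "S \<subseteq> (\<lambda>(I, J). dim_row (submatrix Y I J)) ` (Pow {..<dim_row Y} \<times> Pow {..<dim_col Y})"
    unfolding S_def by auto
  then show "finite S"
    by (rule finite_subset) simp
  have "is_triangle (submatrix Y {} {})"
    unfolding is_triangle_def lower_triangular_pattern_def permute_rows_cols_def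
    by (auto simp: dim_submatrix intro!: exI[of _ id] permutes_id)
  then show "S \<noteq> {}"
    unfolding S_def by blast
qed

lemma min_forcing_size_set_finite_nonempty:
  assumes "graph G" "verts G = V1 \<union> V2"
  defines "S \<equiv> {card F | F. zero_forcing_set G F \<and> forces_from_to G V1 V2 F}"
  shows "finite S" "S \<noteq> {}"
proof -
  interpret graph G by fact
  have "S \<subseteq> card ` Pow (verts G)"
    unfolding S_def zero_forcing_set_def by auto
  then show "finite S"
    by (rule finite_subset) simp
  have "forcing_sequence G (verts G) []"
    by (simp add: forcing_sequence_def)
  moreover have "\<not> forcing_sequence G (verts G) [(v, u)]" for v u
    by (auto simp: forcing_sequence_def can_force_def filled_after_def)
  ultimately have "zero_forcing_set G (verts G)" "forces_from_to G V1 V2 (verts G)"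
    using assms(2)
    by (auto simp: zero_forcing_set_def forces_from_to_def complete_forcing_sequence_def
        filled_after_def intro!: exI[of _ "[]"])
  then show "S \<noteq> {}"
    unfolding S_def by blast
qed

end

theory Submission
  imports Defs
begin

text \<open>
  Both sides count the longest sequence of star entries $(r_0, c_0), (r_1, c_1), \dots$ such that
  row $r_a$ is zero in all later columns $c_b$, $b > a$. Read as matrix positions, such a sequence
  is a triangle. Read as a list of forces, it says that $r_a$ can force $c_a$ as soon as
  $c_0, \dots, c_{a-1}$ are filled, so it is a complete run from the set obtained by leaving exactly
  the vertices $c_a$ unfilled. Conversely, a complete run from a zero forcing set fills the whole
  graph, so its forces number $m + n - |F|$.
\<close>

section \<open>Triangles as sequences of matrix positions\<close>

text \<open>Here \<open>r a\<close> and \<open>c a\<close> are indices into \<open>Y\<close> itself,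
  so a triangle in any row and column order is described without submatrices or permutations. Only
  arguments below \<open>t\<close> matter.\<close>

definition triangle_seq :: "pattern_entry mat \<Rightarrow> nat \<Rightarrow> (nat \<Rightarrow> nat) \<Rightarrow> (nat \<Rightarrow> nat) \<Rightarrow> bool" where
  "triangle_seq Y t r c \<longleftrightarrow>
     (\<forall>a<t. r a < dim_row Y \<and> c a < dim_col Y \<and> Y $$ (r a, c a) = Star) \<and>
     (\<forall>b<t. \<forall>a<b. Y $$ (r a, c b) = Zero)"

text \<open>For a < b a repeated row or column would make the entry at (\<open>r a\<close>,
  \<open>c b\<close>) a diagonal entry of the sequence, hence \<open>Star\<close>, while it is
  required to be \<open>Zero\<close>.\<close>

lemma triangle_seq_inj:
  assumes "triangle_seq Y t r c"
  shows "inj_on r {..<t}" "inj_on c {..<t}"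
proof -
  have "r a \<noteq> r b \<and> c a \<noteq> c b" if "a < b" "b < t" for a b
    using assms that unfolding triangle_seq_def
    by (metis order_less_trans pattern_entry.distinct(1))
  then show "inj_on r {..<t}" "inj_on c {..<t}"
    by (auto intro!: inj_onI) (metis linorder_neqE_nat)+
qed

text \<open>By \<open>card_pick\<close> the index can be recovered from the picked element, which
  gives injectivity; surjectivity follows by counting.\<close>

lemma pick_bij_betw:
  assumes "finite I"
  shows "bij_betw (pick I) {..<card I} I"
proof -
  have "inj_on (pick I) {..<card I}"
    by (auto intro!: inj_onI) (metis card_pick)
  moreover have "pick I ` {..<card I} \<subseteq> I"
    by (auto intro: pick_in_set)
  ultimately show ?thesis
    using assms by (simp add: bij_betw_def card_image card_subset_eq)
qed

text \<open>A submatrix lists its rows in increasing order, a triangle sequence in its own order.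
  The permutation sends \<open>a\<close> to the rank of \<open>f a\<close> in the image of
  \<open>f\<close>.\<close>

lemma reindex_permutes:
  assumes "inj_on f {..<t}"
  obtains p where "p permutes {..<t}" "\<And>a. a < t \<Longrightarrow> pick (f ` {..<t}) (p a) = f a"
proof -
  let ?I = "f ` {..<t}"
  let ?g = "inv_into {..<t} (pick ?I)"
  \<comment> \<open>Outside the range \<open>p\<close> is the identity, as \<open>permutes\<close>
    demands.\<close>
  define p where "p a = (if a < t then ?g (f a) else a)" for a
  have pick: "bij_betw (pick ?I) {..<t} ?I"
    using pick_bij_betw[of ?I] assms by (simp add: card_image)
  have "bij_betw f {..<t} ?I"
    using assms by (simp add: bij_betw_def)
  then have "bij_betw (?g \<circ> f) {..<t} {..<t}"
    using bij_betw_inv_into[OF pick] by (rule bij_betw_trans)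
  then have "bij_betw p {..<t} {..<t}"
    by (rule bij_betw_cong[THEN iffD1, rotated]) (simp add: p_def)
  then have "p permutes {..<t}"
    by (rule bij_imp_permutes) (simp add: p_def)
  moreover have "pick ?I (p a) = f a" if "a < t" for a
    using that pick by (simp add: p_def bij_betw_inv_into_right)
  ultimately show thesis
    by (rule that)
qed

text \<open>Composing the permutations of a triangle with \<open>pick\<close> gives a sequence.
  Conversely, the ranges of \<open>r\<close> and \<open>c\<close> select the submatrix, and
  \<open>reindex_permutes\<close> supplies the permutations that restore the order of the
  sequence.\<close>

lemma submatrix_triangle_iff_triangle_seq:
  "(\<exists>I J. t = dim_row (submatrix Y I J) \<and> I \<subseteq> {..<dim_row Y} \<and> J \<subseteq> {..<dim_col Y} \<and>
      is_triangle (submatrix Y I J)) \<longleftrightarrow>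
   (\<exists>r c. triangle_seq Y t r c)"
proof
  assume "\<exists>I J. t = dim_row (submatrix Y I J) \<and> I \<subseteq> {..<dim_row Y} \<and> J \<subseteq> {..<dim_col Y} \<and>
      is_triangle (submatrix Y I J)"
  then obtain I J where t: "t = dim_row (submatrix Y I J)"
    and tri: "is_triangle (submatrix Y I J)" by blast
  let ?S = "submatrix Y I J"
  from tri t have dims: "dim_row ?S = t" "dim_col ?S = t"
    by (simp_all add: is_triangle_def square_mat.simps)
  from tri dims obtain p q where p: "p permutes {..<t}" and q: "q permutes {..<t}"
    and low: "lower_triangular_pattern (permute_rows_cols p q ?S)"
    and diag: "\<forall>a<t. permute_rows_cols p q ?S $$ (a, a) = Star"
    unfolding is_triangle_def by auto
  define r c where "r = pick I \<circ> p" and "c = pick J \<circ> q"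
  have pq: "p a < t" "q a < t" if "a < t" for a
    using permutes_in_image[OF p, of a] permutes_in_image[OF q, of a] that by auto
  have entry: "permute_rows_cols p q ?S $$ (a, b) = Y $$ (r a, c b)" if "a < t" "b < t" for a b
    using that pq dims
    by (simp add: permute_rows_cols_def r_def c_def submatrix_index dim_submatrix)
  \<comment> \<open>The dimensions of a submatrix count only the selected indices that occur in
    \<open>Y\<close>, so \<open>pick\<close> below them stays within \<open>Y\<close>.\<close>
  have "r a < dim_row Y \<and> c a < dim_col Y" if "a < t" for a
    using pq[OF that] dims by (auto simp: r_def c_def dim_submatrix intro!: pick_le)
  moreover have "Y $$ (r a, c a) = Star" if "a < t" for a
    using diag entry that by simp
  moreover have "Y $$ (r a, c b) = Zero" if "a < b" "b < t" for a b
  proof -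
    have "permute_rows_cols p q ?S $$ (a, b) = Zero"
      using low that dims unfolding lower_triangular_pattern_def
      by (simp add: permute_rows_cols_def)
    then show ?thesis
      using entry that by simp
  qed
  ultimately show "\<exists>r c. triangle_seq Y t r c"
    unfolding triangle_seq_def by blast
next
  assume "\<exists>r c. triangle_seq Y t r c"
  then obtain r c where seq: "triangle_seq Y t r c" by blast
  let ?I = "r ` {..<t}" and ?J = "c ` {..<t}"
  let ?S = "submatrix Y ?I ?J"
  note inj = triangle_seq_inj[OF seq]
  have sub: "?I \<subseteq> {..<dim_row Y}" "?J \<subseteq> {..<dim_col Y}"
    using seq by (auto simp: triangle_seq_def)
  then have "{i. i < dim_row Y \<and> i \<in> ?I} = ?I" "{j. j < dim_col Y \<and> j \<in> ?J} = ?J"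
    by auto
  then have cards: "card {i. i < dim_row Y \<and> i \<in> ?I} = t" "card {j. j < dim_col Y \<and> j \<in> ?J} = t"
    using inj by (simp_all add: card_image)
  then have dims: "dim_row ?S = t" "dim_col ?S = t"
    by (simp_all only: dim_submatrix)
  obtain p where p: "p permutes {..<t}" "\<And>a. a < t \<Longrightarrow> pick ?I (p a) = r a"
    using reindex_permutes[OF inj(1)] by blast
  obtain q where q: "q permutes {..<t}" "\<And>a. a < t \<Longrightarrow> pick ?J (q a) = c a"
    using reindex_permutes[OF inj(2)] by blast
  have entry: "permute_rows_cols p q ?S $$ (a, b) = Y $$ (r a, c b)" if "a < t" "b < t" for a b
  proof -
    have "p a < t" "q b < t"
      using permutes_in_image[OF p(1), of a] permutes_in_image[OF q(1), of b] that by auto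
    then have "?S $$ (p a, q b) = Y $$ (r a, c b)"
      using submatrix_index[of "p a" Y ?I "q b" ?J] cards p(2) q(2) that by simp
    then show ?thesis
      using that dims by (simp add: permute_rows_cols_def)
  qed
  have "lower_triangular_pattern (permute_rows_cols p q ?S)"
    unfolding lower_triangular_pattern_def
  proof (intro allI impI)
    fix a b
    assume "a < dim_row (permute_rows_cols p q ?S)" "b < dim_col (permute_rows_cols p q ?S)" "a < b"
    then have "a < t" "b < t"
      using dims by (simp_all add: permute_rows_cols_def)
    with \<open>a < b\<close> show "permute_rows_cols p q ?S $$ (a, b) = Zero"
      using entry seq by (simp add: triangle_seq_def)
  qed
  moreover have "\<forall>a<t. permute_rows_cols p q ?S $$ (a, a) = Star"
    using entry seq by (simp add: triangle_seq_def)
  ultimately have "is_triangle ?S"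
    unfolding is_triangle_def square_mat.simps dims using p(1) q(1) by blast
  then show "\<exists>I J. t = dim_row (submatrix Y I J) \<and> I \<subseteq> {..<dim_row Y} \<and> J \<subseteq> {..<dim_col Y} \<and>
      is_triangle (submatrix Y I J)"
    by (intro exI[of _ ?I] exI[of _ ?J] conjI) (simp_all only: sub dims)
qed

section \<open>Forcing sequences and their final sets\<close>

lemma filled_after_mono:
  assumes "a \<le> b"
  shows "filled_after F (take a fs) \<subseteq> filled_after F (take b fs)"
  using set_take_subset_set_take[OF assms, of fs] unfolding filled_after_def by blast

lemma filled_after_take_subset: "filled_after F (take a fs) \<subseteq> filled_after F fs"
  unfolding filled_after_def by (auto dest: in_set_takeD)

lemma filled_after_nth:
  assumes "a < b" "a < length fs"
  shows "snd (fs ! a) \<in> filled_after F (take b fs)"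
proof -
  have "fs ! a \<in> set (take b fs)"
    using assms by (auto simp: in_set_conv_nth)
  then show ?thesis
    by (auto simp: filled_after_def)
qed

lemma forcing_sequenceD:
  assumes "forcing_sequence G F fs" "a < length fs"
  shows "can_force G (filled_after F (take a fs)) (fst (fs ! a)) (snd (fs ! a))"
  using assms by (simp add: forcing_sequence_def)

text \<open>A vertex is unfilled just before it is forced, and the filled set only grows. The case
  \<open>a = 0\<close> says that forced vertices lie outside \<open>F\<close>.\<close>

lemma forcing_sequence_later_unfilled:
  assumes "forcing_sequence G F fs" "a \<le> b" "b < length fs"
  shows "snd (fs ! b) \<notin> filled_after F (take a fs)"
proof -
  have "snd (fs ! b) \<notin> filled_after F (take b fs)"
    using forcing_sequenceD[OF assms(1,3)] unfolding can_force_def by blast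
  then show ?thesis
    using filled_after_mono[OF assms(2), of F fs] by blast
qed

text \<open>The definition asks for distinct forcing vertices. The forced ones are distinct because
  an earlier one is already filled when a later one is forced.\<close>

lemma forcing_sequence_inj:
  assumes "forcing_sequence G F fs"
  shows "inj_on (\<lambda>a. snd (fs ! a)) {..<length fs}"
proof -
  have "snd (fs ! a) \<noteq> snd (fs ! b)" if "a < b" "b < length fs" for a b
    using forcing_sequence_later_unfilled[OF assms order_refl that(2)]
      filled_after_nth[of a b fs F] that by auto
  then show ?thesis
    by (auto intro!: inj_onI) (metis linorder_neqE_nat)
qed

lemma card_filled_after:
  assumes "forcing_sequence G F fs" "finite F"
  shows "card (filled_after F fs) = card F + length fs"
proof -
  have snd: "snd ` set fs = (\<lambda>a. snd (fs ! a)) ` {..<length fs}"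
    by (force simp: set_conv_nth)
  then have "card (snd ` set fs) = length fs"
    using forcing_sequence_inj[OF assms(1)] by (simp add: card_image)
  moreover have "F \<inter> snd ` set fs = {}"
    using forcing_sequence_later_unfilled[OF assms(1), of 0] unfolding snd
    by (auto simp: filled_after_def)
  ultimately show ?thesis
    using assms(2) unfolding filled_after_def by (subst card_Un_disjoint) auto
qed

text \<open>The rule that a vertex forces at most once never blocks a force: a vertex that has forced has
  no unfilled neighbour left.\<close>

lemma complete_forcing_sequence_stuck:
  assumes "complete_forcing_sequence G F fs"
  shows "\<not> can_force G (filled_after F fs) v u"
proof
  assume force: "can_force G (filled_after F fs) v u"
  from assms have seq: "forcing_sequence G F fs"
    by (simp add: complete_forcing_sequence_def)
  have "v \<noteq> fst (fs ! a)" if "a < length fs" for a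
  proof
    assume "v = fst (fs ! a)"
    then have "{w \<in> verts G. v \<rightarrow>\<^bsub>G\<^esub> w \<and> w \<notin> filled_after F (take a fs)} = {snd (fs ! a)}"
      using forcing_sequenceD[OF seq that] by (simp add: can_force_def)
    moreover have u: "u \<in> verts G" "v \<rightarrow>\<^bsub>G\<^esub> u" "u \<notin> filled_after F fs"
      using force unfolding can_force_def by blast+
    then have "u \<in> {w \<in> verts G. v \<rightarrow>\<^bsub>G\<^esub> w \<and> w \<notin> filled_after F (take a fs)}"
      using filled_after_take_subset[of F a fs] by auto
    ultimately have "u = snd (fs ! a)"
      by simp
    then show False
      using u(3) that by (auto simp: filled_after_def)
  qed
  then have "v \<notin> fst ` set fs"
    by (auto simp: in_set_conv_nth) (metis fst_conv)
  then have "forcing_sequence G F (fs @ [(v, u)])"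
    using seq force by (auto simp: forcing_sequence_def nth_append less_Suc_eq)
  with assms show False
    unfolding complete_forcing_sequence_def by blast
qed

text \<open>Forcing is monotone: if \<open>v\<close> forces \<open>u\<close> from a subset of
  \<open>S\<close> and \<open>u\<close> is outside \<open>S\<close>, then \<open>u\<close> is still
  the only unfilled neighbour of \<open>v\<close> with respect to \<open>S\<close>. So the first
  force leaving \<open>S\<close> would be possible from \<open>S\<close> as well.\<close>

lemma forcing_sequence_subset_stuck:
  assumes stuck: "\<And>v u. \<not> can_force G S v u"
    and "F \<subseteq> S" "forcing_sequence G F fs"
  shows "filled_after F fs \<subseteq> S"
proof -
  have "filled_after F (take a fs) \<subseteq> S" if "a \<le> length fs" for a
    using that
  proof (induction a)
    case 0
    then show ?case
      using assms(2) by (simp add: filled_after_def)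
  next
    case (Suc a)
    let ?T = "filled_after F (take a fs)" and ?v = "fst (fs ! a)" and ?u = "snd (fs ! a)"
    from Suc have "?T \<subseteq> S" by simp
    moreover have "can_force G ?T ?v ?u"
      using Suc.prems by (intro forcing_sequenceD[OF assms(3)]) simp
    moreover have "\<not> can_force G S ?v ?u"
      by (rule stuck)
    ultimately have "?u \<in> S"
      unfolding can_force_def by blast
    moreover have "filled_after F (take (Suc a) fs) = insert ?u ?T"
      using Suc.prems by (simp add: filled_after_def take_Suc_conv_app_nth)
    ultimately show ?case
      using \<open>?T \<subseteq> S\<close> by simp
  qed
  from this[of "length fs"] show ?thesis
    by simp
qed

text \<open>The run witnessing that \<open>F\<close> is zero forcing may differ from
  \<open>fs\<close>. As the final set of \<open>fs\<close> is stuck, it contains all that the other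
  run fills.\<close>

lemma complete_forcing_sequence_fills:
  assumes "zero_forcing_set G F" "complete_forcing_sequence G F fs"
  shows "verts G \<subseteq> filled_after F fs"
proof -
  from assms(1) obtain gs where "forcing_sequence G F gs" "filled_after F gs = verts G"
    unfolding zero_forcing_set_def by blast
  then show ?thesis
    using forcing_sequence_subset_stuck[OF complete_forcing_sequence_stuck[OF assms(2)], of F gs]
    by (simp add: filled_after_def)
qed

section \<open>Translation between forcing sets and triangle sequences\<close>

lemma triangle_seq_of_forcing_set:
  assumes "graph G"
    and V: "V1 \<inter> V2 = {}" "verts G = V1 \<union> V2"
    and r: "bij_betw r {..<dim_row Y} V1" and c: "bij_betw c {..<dim_col Y} V2"
    and adj: "\<forall>i<dim_row Y. \<forall>j<dim_col Y. r i \<rightarrow>\<^bsub>G\<^esub> c j \<longleftrightarrow> Y $$ (i, j) = Star"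
    and F: "zero_forcing_set G F" "forces_from_to G V1 V2 F"
  shows "\<exists>t r' c'. triangle_seq Y t r' c' \<and> card F + t = dim_row Y + dim_col Y"
proof -
  interpret graph G by fact
  have fin: "finite V1" "finite V2"
    using finite_verts unfolding V(2) by auto
  have sub: "F \<subseteq> verts G"
    using F(1) by (simp add: zero_forcing_set_def)
  then have finF: "finite F"
    using finite_verts finite_subset by blast
  from F(2) obtain fs where fs: "complete_forcing_sequence G F fs"
    and fst: "fst ` set fs \<subseteq> V1" and snd: "snd ` set fs \<subseteq> V2"
    unfolding forces_from_to_def by blast
  from fs have seq: "forcing_sequence G F fs"
    by (simp add: complete_forcing_sequence_def)
  have "filled_after F fs = verts G"
    using complete_forcing_sequence_fills[OF F(1) fs] sub snd V(2) by (auto simp: filled_after_def)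
  then have "card F + length fs = card (V1 \<union> V2)"
    using card_filled_after[OF seq finF] V(2) by simp
  also have "\<dots> = dim_row Y + dim_col Y"
    using card_Un_disjoint[OF fin V(1)] bij_betw_same_card[OF r] bij_betw_same_card[OF c] by simp
  finally have count: "card F + length fs = dim_row Y + dim_col Y" .
  \<comment> \<open>Forcing vertices are read as rows and forced vertices as columns, in the order
    of the forces.\<close>
  define r' c' where "r' a = inv_into {..<dim_row Y} r (fst (fs ! a))"
    and "c' a = inv_into {..<dim_col Y} c (snd (fs ! a))" for a
  have r': "r' a < dim_row Y" "r (r' a) = fst (fs ! a)"
    and c': "c' a < dim_col Y" "c (c' a) = snd (fs ! a)" if "a < length fs" for a
  proof -
    have "fst (fs ! a) \<in> V1" "snd (fs ! a) \<in> V2"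
      using fst snd nth_mem[OF that] by auto
    then show "r' a < dim_row Y" "r (r' a) = fst (fs ! a)" "c' a < dim_col Y" "c (c' a) = snd (fs ! a)"
      using r c bij_betw_inv_into[OF r] bij_betw_inv_into[OF c]
      by (auto simp: r'_def c'_def bij_betw_inv_into_right dest: bij_betwE)
  qed
  have entry: "Y $$ (r' a, c' b) = Star \<longleftrightarrow> fst (fs ! a) \<rightarrow>\<^bsub>G\<^esub> snd (fs ! b)"
    if "a < length fs" "b < length fs" for a b
    using adj r'[OF that(1)] c'[OF that(2)] by metis
  have "Y $$ (r' a, c' a) = Star" if "a < length fs" for a
    using forcing_sequenceD[OF seq that] entry[OF that that] unfolding can_force_def by blast
  moreover have "Y $$ (r' a, c' b) = Zero" if "a < b" "b < length fs" for a b
  proof -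
    have a: "a < length fs" using that by simp
    \<comment> \<open>When the force number \<open>a\<close> happens, its target is the only
      unfilled neighbour of its source. A later target is another unfilled vertex, so it is not
      adjacent to that source.\<close>
    have "snd (fs ! b) \<noteq> snd (fs ! a)"
      using forcing_sequence_inj[OF seq] a that by (auto dest: inj_onD)
    moreover have "snd (fs ! b) \<notin> filled_after F (take a fs)"
      using forcing_sequence_later_unfilled[OF seq] that by simp
    moreover have "snd (fs ! b) \<in> verts G"
      using snd V(2) that by (auto dest: nth_mem)
    ultimately have "\<not> fst (fs ! a) \<rightarrow>\<^bsub>G\<^esub> snd (fs ! b)"
      using forcing_sequenceD[OF seq a] unfolding can_force_def by blast
    then show ?thesis
      using entry[OF a that(2)] pattern_entry.exhaust by metis
  qed
  ultimately have "triangle_seq Y (length fs) r' c'"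
    using r' c' unfolding triangle_seq_def by blast
  with count show ?thesis by blast
qed

text \<open>Edges inside \<open>V1\<close> do no harm since \<open>V1\<close> is filled from the
  start, and edges inside \<open>V2\<close> do none since only vertices of \<open>V1\<close>
  force.\<close>

lemma forcing_set_of_triangle_seq:
  assumes "graph G"
    and V: "V1 \<inter> V2 = {}" "verts G = V1 \<union> V2"
    and r: "bij_betw r {..<dim_row Y} V1" and c: "bij_betw c {..<dim_col Y} V2"
    and adj: "\<forall>i<dim_row Y. \<forall>j<dim_col Y. r i \<rightarrow>\<^bsub>G\<^esub> c j \<longleftrightarrow> Y $$ (i, j) = Star"
    and tri: "triangle_seq Y t r' c'"
  shows "\<exists>F. zero_forcing_set G F \<and> forces_from_to G V1 V2 F \<and> card F + t = dim_row Y + dim_col Y"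
proof -
  interpret graph G by fact
  have fin: "finite V1" "finite V2"
    using finite_verts unfolding V(2) by auto
  define v u where "v = r \<circ> r'" and "u = c \<circ> c'"
  define F where "F = verts G - u ` {..<t}"
  define fs where "fs = map (\<lambda>a. (v a, u a)) [0..<t]"
  have bounds: "r' a < dim_row Y" "c' a < dim_col Y" if "a < t" for a
    using tri that by (auto simp: triangle_seq_def)
  then have vu: "v a \<in> V1" "u a \<in> V2" if "a < t" for a
    using that r c by (auto simp: v_def u_def dest: bij_betwE)
  then have disj: "V1 \<inter> u ` {..<t} = {}"
    using V(1) by blast
  have "inj_on v {..<t}"
    unfolding v_def using triangle_seq_inj(1)[OF tri] bounds r
    by (intro comp_inj_on) (auto simp: bij_betw_def intro: inj_on_subset)
  then have fs_dist: "distinct (map fst fs)"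
    by (simp add: fs_def comp_def distinct_map lessThan_atLeast0)
  have inj_u: "inj_on u {..<t}"
    unfolding u_def using triangle_seq_inj(2)[OF tri] bounds c
    by (intro comp_inj_on) (auto simp: bij_betw_def intro: inj_on_subset)
  have filled: "filled_after F (take a fs) = F \<union> u ` {..<a}" if "a \<le> t" for a
    using that by (auto simp: filled_after_def fs_def take_map image_image)
  have adj': "v a \<rightarrow>\<^bsub>G\<^esub> u b \<longleftrightarrow> Y $$ (r' a, c' b) = Star" if "a < t" "b < t" for a b
    using adj bounds that by (simp add: v_def u_def)
  have force: "can_force G (F \<union> u ` {..<a}) (v a) (u a)" if a: "a < t" for a
  proof -
    let ?W = "{w \<in> verts G. v a \<rightarrow>\<^bsub>G\<^esub> w \<and> w \<notin> F \<union> u ` {..<a}}"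
    have "v a \<in> F"
      using vu(1)[OF a] disj V(2) by (auto simp: F_def)
    moreover have only: "w = u a" if w: "w \<in> verts G" "v a \<rightarrow>\<^bsub>G\<^esub> w" "w \<notin> F \<union> u ` {..<a}" for w
    proof -
      \<comment> \<open>Every vertex unfilled at this time is some \<open>u b\<close> with b \<ge>
        a, and for b > a the entry is \<open>Zero\<close>.\<close>
      obtain b where b: "b < t" "w = u b" "\<not> b < a"
        using w by (auto simp: F_def)
      moreover have "Y $$ (r' a, c' b) \<noteq> Zero"
        using w(2) adj'[OF a b(1)] b(2) by simp
      then have "\<not> a < b"
        using tri b(1) by (auto simp: triangle_seq_def)
      ultimately show ?thesis
        by simp
    qed
    moreover have "u a \<in> verts G" "u a \<notin> F"
      using vu a V(2) by (auto simp: F_def)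
    moreover have "u a \<notin> u ` {..<a}"
      using inj_u a by (auto dest: inj_onD)
    moreover have "v a \<rightarrow>\<^bsub>G\<^esub> u a"
      using adj' tri a by (simp add: triangle_seq_def)
    ultimately have in_W: "u a \<in> ?W"
      by blast
    have "?W \<subseteq> {u a}"
    proof
      fix w assume "w \<in> ?W"
      then have "w = u a"
        by (intro only) blast+
      then show "w \<in> {u a}" by simp
    qed
    with in_W have "?W = {u a}"
      by (metis empty_iff subset_singletonD)
    with \<open>v a \<in> F\<close> show ?thesis
      by (simp add: can_force_def)
  qed
  have seq: "forcing_sequence G F fs"
    unfolding forcing_sequence_def
  proof (intro conjI allI impI)
    show "F \<subseteq> verts G" by (auto simp: F_def)
    show "distinct (map fst fs)" by (fact fs_dist)
  next
    fix a assume "a < length fs"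
    then have "a < t" by (simp add: fs_def)
    then show "can_force G (filled_after F (take a fs)) (fst (fs ! a)) (snd (fs ! a))"
      using force[of a] filled[of a] by (simp add: fs_def)
  qed
  have all: "filled_after F fs = verts G"
    using filled[of t] vu V(2) by (auto simp: F_def fs_def)
  \<comment> \<open>Completeness is immediate: no vertex is left to be forced.\<close>
  have "\<not> forcing_sequence G F (fs @ [(x, y)])" for x y
  proof
    assume "forcing_sequence G F (fs @ [(x, y)])"
    from forcing_sequenceD[OF this, of "length fs"] show False
      using all by (auto simp: can_force_def)
  qed
  with seq have "complete_forcing_sequence G F fs"
    by (simp add: complete_forcing_sequence_def)
  moreover have "fst ` set fs \<subseteq> V1" "snd ` set fs \<subseteq> V2"
    using vu by (auto simp: fs_def)
  moreover have "V1 \<subseteq> F"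
    using disj V(2) by (auto simp: F_def)
  ultimately have "forces_from_to G V1 V2 F"
    unfolding forces_from_to_def by blast
  moreover have "zero_forcing_set G F"
    unfolding zero_forcing_set_def using seq all by (auto simp: F_def)
  moreover have "card F + t = dim_row Y + dim_col Y"
  proof -
    have "card F + t = card (V1 \<union> V2)"
      using card_filled_after[OF seq] all V(2) finite_verts by (simp add: F_def fs_def)
    also have "\<dots> = dim_row Y + dim_col Y"
      using card_Un_disjoint[OF fin V(1)] bij_betw_same_card[OF r] bij_betw_same_card[OF c] by simp
    finally show ?thesis .
  qed
  ultimately show ?thesis by blast
qed

section \<open>Comparison of the two extremal values\<close>

theorem theorem3p5:
  fixes Y :: "pattern_entry mat"
    and G :: "('a, 'b) pre_digraph"
    and V1 V2 :: "'a set"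
    and m n k :: nat
  assumes "Y \<in> carrier_mat m n"
    and "graph G"
    and "partition_according G Y V1 V2"
    and "k = min_forcing_size G V1 V2"
  shows "int (tri Y) = int m + int n - int k"
proof -
  from assms(3) obtain r c where V: "V1 \<inter> V2 = {}" "verts G = V1 \<union> V2"
    and bij: "bij_betw r {..<dim_row Y} V1" "bij_betw c {..<dim_col Y} V2"
    and adj: "\<forall>i<dim_row Y. \<forall>j<dim_col Y. r i \<rightarrow>\<^bsub>G\<^esub> c j \<longleftrightarrow> Y $$ (i, j) = Star"
    unfolding partition_according_def by blast
  note to_seq = triangle_seq_of_forcing_set[OF assms(2) V bij adj]
    and of_seq = forcing_set_of_triangle_seq[OF assms(2) V bij adj]
  have dims: "dim_row Y = m" "dim_col Y = n"
    using assms(1) by auto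
  let ?T = "{dim_row (submatrix Y I J) | I J.
     I \<subseteq> {..<dim_row Y} \<and> J \<subseteq> {..<dim_col Y} \<and> is_triangle (submatrix Y I J)}"
  let ?K = "{card F | F. zero_forcing_set G F \<and> forces_from_to G V1 V2 F}"
  have T: "t \<in> ?T \<longleftrightarrow> (\<exists>r c. triangle_seq Y t r c)" for t
    using submatrix_triangle_iff_triangle_seq[of t Y] by simp
  have tri: "tri Y \<in> ?T" "\<And>t. t \<in> ?T \<Longrightarrow> t \<le> tri Y"
    unfolding tri_def
    by (rule Max_in[OF tri_set_finite_nonempty], rule Max_ge[OF tri_set_finite_nonempty(1)])
  have k: "k \<in> ?K" "\<And>l. l \<in> ?K \<Longrightarrow> k \<le> l"
    unfolding assms(4) min_forcing_size_def
    by (rule Min_in[OF min_forcing_size_set_finite_nonempty[OF assms(2) V(2)]],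
        rule Min_le[OF min_forcing_size_set_finite_nonempty(1)[OF assms(2) V(2)]])
  \<comment> \<open>A largest triangle yields a forcing set, so k + \<open>tri Y\<close> \<le> m +
    n.\<close>
  from tri(1) obtain r' c' where "triangle_seq Y (tri Y) r' c'"
    unfolding T by blast
  from of_seq[OF this] obtain F
    where F: "zero_forcing_set G F" "forces_from_to G V1 V2 F" "card F + tri Y = m + n"
    unfolding dims by blast
  then have "k \<le> card F"
    by (intro k(2)) blast
  \<comment> \<open>A smallest forcing set yields a triangle of size m + n - k, which gives the
    reverse inequality.\<close>
  from k(1) obtain F' where F': "zero_forcing_set G F'" "forces_from_to G V1 V2 F'" "k = card F'"
    by blast
  from to_seq[OF F'(1,2)] obtain t r'' c''
    where t: "triangle_seq Y t r'' c''" "k + t = m + n"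
    unfolding dims F'(3) by blast
  then have "t \<le> tri Y"
    using T by (intro tri(2)) blast
  show ?thesis
    using F(3) t(2) \<open>t \<le> tri Y\<close> \<open>k \<le> card F\<close> by linarith
qed

end
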